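(* Suppose $P_{n,K}$ is full-dimensional, and let $u,v\in V$ with $v\ge 4$ and $u<v$. The inequality $x_{u,v}+x_v\le 1$ is facet-defining for $P_{n,K}$ if and only if $n\ge 6$ or $\{u,v\}\ne\{4,5\}$.
   Context: $V=\{1,\dots,n\}$ and $E$ is the set of all unordered pairs $ij$ of distinct elements of $V$; $x_{i,j}=x_{j,i}$. A $K$-partition $\pi$ is a collection of $K$ non-empty pairwise disjoint subsets (clusters) of $V$ whose union is $V$. The representative of a cluster is its smallest element. The characteristic vector $x^\pi\in\{0,1\}^{|E|+|V|-3}$ of $\pi$ has components $x_4,\dots,x_n$ and $x_{i,j}$ for $ij\in E$, where $x^\pi_{i,j}=1$ if $i,j$ are in the same cluster and $0$ otherwise, and $x^\pi_u=1$ if $u$ is the representative of its cluster and $0$ otherwise. (Representative variables of vertices $1,2,3$ are not coordinates.) $P_{n,K}\subset\mathbb R^{|E|+|V|-3}$ is the convex hull of the characteristic vectors $x^\pi$ of all $K$-partitions $\pi$ of $V$ (equivalently, of all $0/1$ solutions of the integer formulation of the $K$-partitioning problem). It is full-dimensional (dimension $|E|+|V|-3$) if and only if $K\in\{3,\dots,n-2\}$. An inequality is facet-defining for $P_{n,K}$ if it is valid for $P_{n,K}$ and the set of points of $P_{n,K}$ satisfying it with equality has dimension $\dim(P_{n,K})-1$. *)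

theory Defs
  imports "HOL-Analysis.Analysis" "HOL-Library.Disjoint_Sets"
begin

definition vertices :: "nat \<Rightarrow> nat set" where
  "vertices n = {1..n}"

definition edges :: "nat \<Rightarrow> nat set set" where
  "edges n = {e. e \<subseteq> vertices n \<and> card e = 2}"

text \<open>Names of the coordinates: \<open>Edge {i, j}\<close> stands for $x_{i,j} = x_{j,i}$
  and \<open>Rep u\<close> for $x_u$.\<close>

datatype coord = Edge "nat set" | Rep nat

definition coords :: "nat \<Rightarrow> coord set" where
  "coords n = Edge ` edges n \<union> Rep ` {4..n}"

lemma card_coords:
  assumes "n \<ge> 3"
  shows "card (coords n) = card (edges n) + card (vertices n) - 3"
proof -
  have "finite (edges n)"
    by (rule finite_subset[of _ "Pow (vertices n)"]) (auto simp: edges_def vertices_def)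
  then have "card (coords n) = card (Edge ` edges n) + card (Rep ` {4..n})"
    unfolding coords_def by (intro card_Un_disjoint) auto
  also have "\<dots> = card (edges n) + (n - 3)"
    by (simp add: card_image inj_on_def)
  finally show ?thesis
    using assms by (simp add: vertices_def)
qed

definition K_partition :: "nat \<Rightarrow> nat \<Rightarrow> nat set set \<Rightarrow> bool" where
  "K_partition n K \<pi> \<longleftrightarrow> partition_on (vertices n) \<pi> \<and> card \<pi> = K"

definition representatives :: "nat set set \<Rightarrow> nat set" where
  "representatives \<pi> = Min ` \<pi>"

fun char_entry :: "nat set set \<Rightarrow> coord \<Rightarrow> real" where
  "char_entry \<pi> (Edge e) = of_bool (\<exists>C\<in>\<pi>. e \<subseteq> C)"
| "char_entry \<pi> (Rep u) = of_bool (u \<in> representatives \<pi>)"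

text \<open>The ambient space, of dimension $|E| + |V| - 3$, is \<open>real ^ 'e\<close>, where
  \<open>pos\<close> is a bijection from \<open>coords n\<close> onto the index type \<open>'e\<close>:
  component \<open>pos c\<close> of a vector is its coordinate named \<open>c\<close>.\<close>

definition char_vec :: "nat \<Rightarrow> (coord \<Rightarrow> 'e::finite) \<Rightarrow> nat set set \<Rightarrow> real ^ 'e" where
  "char_vec n pos \<pi> = (\<chi> i. char_entry \<pi> (inv_into (coords n) pos i))"

definition partition_polytope :: "nat \<Rightarrow> nat \<Rightarrow> (coord \<Rightarrow> 'e::finite) \<Rightarrow> (real ^ 'e) set" where
  "partition_polytope n K pos = convex hull (char_vec n pos ` {\<pi>. K_partition n K \<pi>})"

definition full_dimensional :: "'a::euclidean_space set \<Rightarrow> bool" where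
  "full_dimensional P \<longleftrightarrow> aff_dim P = int DIM('a)"

text \<open>\<open>facet_defining P f b\<close>: the inequality \<open>f x \<le> b\<close>, for a linear form \<open>f\<close>,
  is facet-defining for \<open>P\<close>.\<close>

definition facet_defining :: "'a::euclidean_space set \<Rightarrow> ('a \<Rightarrow> real) \<Rightarrow> real \<Rightarrow> bool" where
  "facet_defining P f b \<longleftrightarrow>
     (\<forall>x\<in>P. f x \<le> b) \<and> aff_dim {x\<in>P. f x = b} = aff_dim P - 1"

end

theory Submission
  imports Defs
begin

text \<open>
  Suppose a linear equation \<open>a x = b\<close> holds at every $K$-partition on the face, where either
  \<open>u, v\<close> share a cluster or \<open>v\<close> is a representative. A linear form is additive over clusters, so
  moving one vertex \<open>s\<close> from a cluster to another changes its value by the difference of two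
  increments, each depending on one cluster only. Comparing such moves of \<open>s\<close> out of the
  cluster of \<open>u, v\<close> with moves made while \<open>v\<close> is a singleton shows that \<open>a\<^sub>s\<^sub>v = 0\<close> for
  \<open>s \<noteq> u, v\<close>. Moving \<open>v\<close> itself into the cluster of \<open>u\<close> then shows that \<open>a\<close> takes the single
  value \<open>b - a\<^sub>u\<^sub>v\<close> at all partitions off the face. If \<open>a x = b\<close> also holds at one of those, it holds on the
  whole polytope, and full dimension forces \<open>a = 0\<close>; so the face together with one point off it
  spans the whole space. For $n = 5$, \<open>u = 4\<close>, \<open>v = 5\<close> the face satisfies a second, independent
  equation.
\<close>

section \<open>Affine dimension and hyperplanes\<close>

text \<open>A nonzero linear form is the inner product with a nonzero vector; being constant on
  \<open>S\<close>, it would put the whole hull into a hyperplane.\<close>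

lemma full_dimensional_linear_const:
  fixes h :: "'a::euclidean_space \<Rightarrow> real"
  assumes full: "full_dimensional (convex hull S)" and h: "linear h"
    and const: "\<And>x. x \<in> S \<Longrightarrow> h x = c"
  shows "h x = 0"
proof -
  obtain a where a: "h = (\<bullet>) a"
  proof
    show "h = (\<bullet>) (adjoint h 1)"
      using adjoint_works[OF h, of _ 1] by (simp add: fun_eq_iff inner_commute)
  qed
  have sub: "convex hull S \<subseteq> {x. a \<bullet> x = c}"
    using const by (intro hull_minimal convex_hyperplane) (auto simp: a)
  have "a = 0"
  proof (rule ccontr)
    assume "a \<noteq> 0"
    then have "aff_dim (convex hull S) \<le> DIM('a) - 1"
      using aff_dim_subset[OF sub] by (simp add: aff_dim_hyperplane)
    then show False
      using full by (simp add: full_dimensional_def)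
  qed
  then show ?thesis by (simp add: a)
qed

text \<open>The given hyperplane bounds the dimension from above. From below: one point raises the
  affine dimension by at most 1, and no hyperplane contains \<open>insert p S\<close>.\<close>

lemma aff_dim_eq_DIM_minus_1:
  fixes S :: "'a::euclidean_space set" and a :: 'a
  assumes "a \<noteq> 0" and sub: "S \<subseteq> {x. a \<bullet> x = b}"
    and indep: "\<And>a' b'. (\<And>x. x \<in> insert p S \<Longrightarrow> a' \<bullet> x = b') \<Longrightarrow> a' = 0"
  shows "aff_dim S = int DIM('a) - 1"
proof (rule antisym)
  show "aff_dim S \<le> int DIM('a) - 1"
    using aff_dim_subset[OF sub] assms(1) by (simp add: aff_dim_hyperplane)
  have "\<not> aff_dim (insert p S) < DIM('a)"
    using aff_lowdim_subset_hyperplane[of "insert p S"] indep by (metis (mono_tags) mem_Collect_eq subsetD)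
  then show "int DIM('a) - 1 \<le> aff_dim S"
    by (auto simp: aff_dim_insert split: if_splits)
qed

text \<open>The point \<open>p\<close> shows that the first hyperplane is not contained in the
  second, so their intersection is empty or has codimension 2.\<close>

lemma aff_dim_two_hyperplanes:
  fixes S :: "'a::euclidean_space set" and a a' :: 'a
  assumes "S \<subseteq> {x. a \<bullet> x = b}" and "S \<subseteq> {x. a' \<bullet> x = b'}"
    and "a \<noteq> 0" and "a \<bullet> p = b" and "a' \<bullet> p \<noteq> b'"
  shows "aff_dim S < int DIM('a) - 1"
proof -
  have "aff_dim S \<le> aff_dim ({x. a \<bullet> x = b} \<inter> {x. a' \<bullet> x = b'})"
    using assms by (intro aff_dim_subset) auto
  also have "\<dots> < int DIM('a) - 1"
    using assms by (subst aff_dim_affine_Int_hyperplane) (auto simp: affine_hyperplane aff_dim_hyperplane)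
  finally show ?thesis .
qed

text \<open>Singletons are split off until one block is left. This serves to complete a few chosen
  clusters to a \<open>K\<close>-partition.\<close>

lemma exists_partition_on_card:
  assumes "finite W" and "k \<le> card W" and "k = 0 \<Longrightarrow> W = {}"
  shows "\<exists>Q. partition_on W Q \<and> card Q = k"
  using assms
proof (induction k arbitrary: W)
  case 0
  then show ?case by (auto simp: partition_on_empty)
next
  case (Suc k)
  show ?case
  proof (cases "k = 0")
    case True
    with Suc.prems show ?thesis
      by (intro exI[of _ "{W}"]) (auto intro: partition_on_space)
  next
    case False
    from Suc.prems obtain x where x: "x \<in> W" by fastforce
    obtain Q where Q: "partition_on (W - {x}) Q" "card Q = k"
      using Suc.IH[of "W - {x}"] Suc.prems x False by fastforce
    have "finite Q" using Q(1) Suc.prems finite_elements by blast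
    have "{x} \<notin> Q" using partition_onD1[OF Q(1)] by blast
    have "partition_on W (insert {x} Q)"
      using Q(1) x \<open>{x} \<notin> Q\<close> by (subst partition_on_insert) (auto simp: disjnt_iff dest: partition_onD1)
    then show ?thesis
      using Q \<open>finite Q\<close> \<open>{x} \<notin> Q\<close> by (intro exI[of _ "insert {x} Q"]) auto
  qed
qed

section \<open>Linear forms as sums of cluster weights\<close>

text \<open>Vertices 1, 2, 3 have no representative coordinate, hence the value 0.\<close>

definition rep_weight :: "(coord \<Rightarrow> real) \<Rightarrow> nat \<Rightarrow> real" where
  "rep_weight a w = (if w \<ge> 4 then a (Rep w) else 0)"

definition weight :: "(coord \<Rightarrow> real) \<Rightarrow> nat set \<Rightarrow> real" where
  "weight a C = (\<Sum>e | e \<subseteq> C \<and> card e = 2. a (Edge e)) + rep_weight a (Min C)"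

definition form_value :: "nat \<Rightarrow> (coord \<Rightarrow> real) \<Rightarrow> nat set set \<Rightarrow> real" where
  "form_value n a \<pi> = (\<Sum>c\<in>coords n. a c * char_entry \<pi> c)"

definition increment :: "(coord \<Rightarrow> real) \<Rightarrow> nat \<Rightarrow> nat set \<Rightarrow> real" where
  "increment a s D = weight a (insert s D) - weight a D"

text \<open>The new pairs are those containing \<open>s\<close>; apart from them only the minimum
  can change.\<close>

lemma increment_eq:
  assumes "finite D" "s \<notin> D"
  shows "increment a s D =
    (\<Sum>t\<in>D. a (Edge {s, t})) + rep_weight a (Min (insert s D)) - rep_weight a (Min D)"
proof -
  have eq: "{e. e \<subseteq> insert s D \<and> card e = 2} =
      {e. e \<subseteq> D \<and> card e = 2} \<union> (\<lambda>t. {s, t}) ` D"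
  proof (intro equalityI subsetI)
    fix e assume e: "e \<in> {e. e \<subseteq> insert s D \<and> card e = 2}"
    then obtain x y where "e = {x, y}" "x \<noteq> y" by (auto simp: card_2_iff)
    with e show "e \<in> {e. e \<subseteq> D \<and> card e = 2} \<union> (\<lambda>t. {s, t}) ` D" by auto
  qed (use assms in \<open>auto simp: card_2_iff\<close>)
  have "(\<Sum>e | e \<subseteq> insert s D \<and> card e = 2. a (Edge e)) =
      (\<Sum>e | e \<subseteq> D \<and> card e = 2. a (Edge e)) + (\<Sum>e\<in>(\<lambda>t. {s, t}) ` D. a (Edge e))"
    unfolding eq using assms by (intro sum.union_disjoint) auto
  also have "(\<Sum>e\<in>(\<lambda>t. {s, t}) ` D. a (Edge e)) = (\<Sum>t\<in>D. a (Edge {s, t}))"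
    using assms by (subst sum.reindex) (auto simp: inj_on_def doubleton_eq_iff)
  finally show ?thesis by (simp add: increment_def weight_def)
qed

text \<open>As \<open>t\<close> in \<open>D\<close> is below \<open>M\<close>, adding
  \<open>M\<close> changes neither minimum. Comparing two such increments isolates a single edge
  coefficient.\<close>

lemma increment_insert:
  assumes "finite D" "s \<notin> D" "M \<notin> D" "M \<noteq> s" "t \<in> D" "t < M"
  shows "increment a s (insert M D) = increment a s D + a (Edge {s, M})"
proof -
  have "Min (insert M D) = Min D"
    using assms by (subst Min_insert) (auto simp: min_def intro: Min_le order_trans dest: less_imp_le,
      metis Min_le le_less_trans less_imp_le order_antisym_conv not_le)
  moreover have "Min (insert s (insert M D)) = Min (insert s D)"
    using assms calculation by (metis Min_insert empty_iff finite_insert insert_not_empty)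
  ultimately show ?thesis
    using assms by (simp add: increment_eq)
qed

text \<open>An element below \<open>s\<close> keeps the minimum, so the two representative terms
  cancel.\<close>

lemma increment_above:
  assumes "finite D" "s \<notin> D" "t \<in> D" "t < s"
  shows "increment a s D = (\<Sum>t\<in>D. a (Edge {s, t}))"
proof -
  have "Min D \<le> t" using assms by simp
  then have "Min (insert s D) = Min D"
    using assms by (subst Min_insert) (auto intro!: min_absorb2 order.trans[of "Min D" t s])
  then show ?thesis using assms by (simp add: increment_eq)
qed

lemma finite_edges: "finite (edges n)"
  by (rule finite_subset[of _ "Pow (vertices n)"]) (auto simp: edges_def vertices_def)

lemma sum_coords:
  "(\<Sum>c\<in>coords n. g c) = (\<Sum>e\<in>edges n. g (Edge e)) + (\<Sum>w=4..n. g (Rep w))"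
proof -
  have "(\<Sum>c\<in>coords n. g c) = (\<Sum>c\<in>Edge ` edges n. g c) + (\<Sum>c\<in>Rep ` {4..n}. g c)"
    unfolding coords_def by (intro sum.union_disjoint) (auto simp: finite_edges)
  then show ?thesis
    by (simp add: sum.reindex inj_on_def)
qed

lemma inj_on_Min_partition:
  assumes "partition_on A P" "finite A"
  shows "inj_on Min P"
proof (rule inj_onI)
  fix C D assume "C \<in> P" "D \<in> P" "Min C = Min D"
  moreover have "finite C" "finite D" "C \<noteq> {}" "D \<noteq> {}"
    using assms calculation by (auto simp: partition_on_def intro: finite_subset)
  ultimately have "Min C \<in> C \<inter> D" by (metis Min_in IntI)
  then show "C = D"
    using assms \<open>C \<in> P\<close> \<open>D \<in> P\<close> by (auto simp: partition_on_def disjoint_def)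
qed

text \<open>Every joined pair lies in exactly one cluster, and distinct clusters have distinct
  minima, so both kinds of coordinates can be summed cluster by cluster.\<close>

lemma form_value_eq_sum_weight:
  assumes \<pi>: "partition_on (vertices n) \<pi>"
  shows "form_value n a \<pi> = (\<Sum>C\<in>\<pi>. weight a C)"
proof -
  have fin: "finite \<pi>" using \<pi> finite_elements by (auto simp: vertices_def)
  have C: "finite C" "C \<noteq> {}" "C \<subseteq> vertices n" if "C \<in> \<pi>" for C
    using \<pi> that finite_subset[of C "vertices n"] by (auto simp: partition_on_def vertices_def)
  have disj: "C \<inter> D = {}" if "C \<in> \<pi>" "D \<in> \<pi>" "C \<noteq> D" for C D
    using \<pi> that by (auto simp: partition_on_def disjoint_def)
  have "(\<Sum>e\<in>edges n. a (Edge e) * char_entry \<pi> (Edge e)) =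
      (\<Sum>e\<in>(\<Union>C\<in>\<pi>. {e. e \<subseteq> C \<and> card e = 2}). a (Edge e))"
    using C(3) finite_edges[of n]
    by (intro sum.mono_neutral_cong_right) (auto simp: edges_def)
  also have "\<dots> = (\<Sum>C\<in>\<pi>. \<Sum>e | e \<subseteq> C \<and> card e = 2. a (Edge e))"
  proof (rule sum.UNION_disjoint)
    show "\<forall>C\<in>\<pi>. \<forall>D\<in>\<pi>. C \<noteq> D \<longrightarrow>
        {e. e \<subseteq> C \<and> card e = 2} \<inter> {e. e \<subseteq> D \<and> card e = 2} = {}"
      using disj by (fastforce simp: card_2_iff)
  qed (use fin C in auto)
  finally have E: "(\<Sum>e\<in>edges n. a (Edge e) * char_entry \<pi> (Edge e)) =
      (\<Sum>C\<in>\<pi>. \<Sum>e | e \<subseteq> C \<and> card e = 2. a (Edge e))" .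
  have Min: "Min C \<in> {1..n}" if "C \<in> \<pi>" for C
    using C[OF that] Min_in[of C] by (fastforce simp: vertices_def)
  \<comment> \<open>Minima below 4 occur on the right only, non-minimal \<open>w\<close> on the left
    only; both contribute 0.\<close>
  have "(\<Sum>w=4..n. a (Rep w) * char_entry \<pi> (Rep w)) = (\<Sum>w\<in>Min ` \<pi>. rep_weight a w)"
    using Min fin
    by (intro sum.mono_neutral_cong) (auto simp: representatives_def rep_weight_def)
  also have "\<dots> = (\<Sum>C\<in>\<pi>. rep_weight a (Min C))"
    using inj_on_Min_partition[OF \<pi>] by (simp add: sum.reindex vertices_def)
  finally show ?thesis
    using E by (simp add: form_value_def sum_coords weight_def sum.distrib)
qed

section \<open>Adding clusters and vertices to a partition\<close>

lemma partition_on_insert_disjoint: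
  assumes "partition_on W Q" "D \<noteq> {}" "D \<inter> W = {}"
  shows "partition_on (D \<union> W) (insert D Q)" and "D \<notin> Q"
proof -
  have "D \<union> W - D = W" using assms by blast
  then show "partition_on (D \<union> W) (insert D Q)"
    using assms partition_onD1[OF assms(1)]
    by (subst partition_on_insert) (auto simp: disjnt_def)
  show "D \<notin> Q"
    using assms partition_onD1[OF assms(1)] by blast
qed

lemma partition_on_insert_element:
  assumes P: "partition_on (A - {s}) P" and "s \<in> A" "D \<in> P"
  shows "partition_on A (insert (insert s D) (P - {D}))"
proof -
  have D: "D \<subseteq> A - {s}" and disj: "\<And>C. C \<in> P - {D} \<Longrightarrow> C \<inter> D = {}"
    using P \<open>D \<in> P\<close> by (auto simp: partition_on_def disjoint_def)
  have "partition_on (A - {s} - D) (P - {D})"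
    using partition_on_insert[of D "P - {D}" "A - {s}"] P \<open>D \<in> P\<close> disj
    by (auto simp: insert_absorb disjnt_def)
  moreover have "insert s D \<union> (A - {s} - D) = A"
    using D \<open>s \<in> A\<close> by auto
  ultimately show ?thesis
    using partition_on_insert_disjoint(1)[of "A - {s} - D" "P - {D}" "insert s D"]
    by auto
qed

text \<open>The sum over \<open>P\<close> does not depend on \<open>D\<close>, so two placements of
  \<open>s\<close> differ only by their increments.\<close>

lemma form_value_insert_element:
  assumes P: "partition_on (vertices n - {s}) P" and "s \<in> vertices n" "D \<in> P"
  shows "K_partition n (card P) (insert (insert s D) (P - {D}))"
    and "form_value n a (insert (insert s D) (P - {D})) = (\<Sum>C\<in>P. weight a C) + increment a s D"
proof -
  let ?\<pi> = "insert (insert s D) (P - {D})"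
  note \<pi> = partition_on_insert_element[OF assms]
  have fin: "finite P" using finite_elements[OF _ P] by (simp add: vertices_def)
  have notin: "insert s D \<notin> P - {D}" using P by (auto simp: partition_on_def)
  show "K_partition n (card P) ?\<pi>"
    unfolding K_partition_def using \<pi> fin notin \<open>D \<in> P\<close> card_gt_0_iff[of P] by auto
  show "form_value n a ?\<pi> = (\<Sum>C\<in>P. weight a C) + increment a s D"
    using form_value_eq_sum_weight[OF \<pi>, of a] fin notin
      sum.remove[OF fin \<open>D \<in> P\<close>, of "weight a"]
    by (simp add: increment_def)
qed

section \<open>Equations that hold on the face\<close>

text \<open>An equation that holds on the face. Among the partitions with \<open>v\<close> as a
  representative, those with \<open>v\<close> alone suffice for the exchanges below.\<close>

locale constant_on_face =
  fixes n K u v :: nat and a :: "coord \<Rightarrow> real" and b :: real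
  assumes u: "u \<in> vertices n" and v: "v \<in> vertices n" and less: "u < v"
    and const: "\<And>\<pi>. K_partition n K \<pi> \<Longrightarrow> (\<exists>C\<in>\<pi>. {u, v} \<subseteq> C) \<or> {v} \<in> \<pi> \<Longrightarrow>
      form_value n a \<pi> = b"
begin

text \<open>Placing \<open>s\<close> in \<open>D\<close> or in \<open>E\<close> gives two face
  partitions over the same base sum. A cluster containing \<open>u\<close> and \<open>v\<close>
  survives the insertion; a singleton \<open>{v}\<close> does so only if it is neither
  \<open>D\<close> nor \<open>E\<close>.\<close>

lemma exchange:
  assumes P: "partition_on (vertices n - {s}) P" "card P = K" and s: "s \<in> vertices n"
    and DE: "D \<in> P" "E \<in> P"
    and face: "(\<exists>C\<in>P. {u, v} \<subseteq> C) \<or> {v} \<in> P - {D, E}"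
  shows "increment a s D = increment a s E"
proof -
  have "(\<Sum>C\<in>P. weight a C) + increment a s F = b" if F: "F \<in> P" "F \<in> {D, E}" for F
  proof -
    let ?\<pi> = "insert (insert s F) (P - {F})"
    have "(\<exists>C\<in>?\<pi>. {u, v} \<subseteq> C) \<or> {v} \<in> ?\<pi>"
      using face
    proof
      assume "\<exists>C\<in>P. {u, v} \<subseteq> C"
      then obtain C where C: "C \<in> P" "{u, v} \<subseteq> C" by blast
      show ?thesis
      proof (cases "C = F")
        case True
        then have "{u, v} \<subseteq> insert s F" using C by blast
        then show ?thesis by blast
      qed (use C in blast)
    qed (use F in auto)
    moreover have "K_partition n K ?\<pi>"
      using form_value_insert_element(1)[OF P(1) s F(1)] P(2) by simp
    ultimately have "form_value n a ?\<pi> = b" by (intro const)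
    then show ?thesis
      using form_value_insert_element(2)[OF P(1) s F(1)] by simp
  qed
  from this[of D] this[of E] show ?thesis using DE by auto
qed

text \<open>This is \<open>exchange\<close> between \<open>insert v D\<close> and \<open>E\<close>.
  Since \<open>u\<close> in \<open>D\<close> is below \<open>v\<close>, adding \<open>v\<close> to
  \<open>D\<close> contributes exactly the coefficient of \<open>{s, v}\<close>.\<close>

lemma increment_exchange_joined:
  assumes s: "s \<in> vertices n" "s \<noteq> v" and DE: "u \<in> D" "E \<noteq> {}" "D \<inter> E = {}"
      "D \<union> E \<subseteq> vertices n - {s, v}"
    and K: "K \<ge> 3" "K - 2 \<le> card (vertices n - {s, v} - (D \<union> E))"
  shows "increment a s E = increment a s D + a (Edge {s, v})"
proof -
  let ?W = "vertices n - {s, v} - (D \<union> E)"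
  have fin: "finite (vertices n)" by (simp add: vertices_def)
  \<comment> \<open>Two clusters are fixed already. By \<open>K \<ge> 3\<close> the number
    \<open>K - 2\<close> is positive, so a non-empty rest is never to be split into no
    clusters.\<close>
  obtain Q where Q: "partition_on ?W Q" "card Q = K - 2"
    using exists_partition_on_card[of ?W "K - 2"] K fin by auto
  have Q': "finite Q" using Q(1) fin by (meson finite_Diff finite_elements)
  have 1: "partition_on (E \<union> ?W) (insert E Q)" "E \<notin> Q"
    using partition_on_insert_disjoint[OF Q(1) DE(2)] by auto
  have 2: "partition_on (insert v D \<union> (E \<union> ?W)) (insert (insert v D) (insert E Q))"
      "insert v D \<notin> insert E Q"
    using partition_on_insert_disjoint[OF 1(1), of "insert v D"] DE by auto
  have *: "insert v D \<union> (E \<union> ?W) = vertices n - {s}"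
    using v s DE by auto
  have "increment a s (insert v D) = increment a s E"
    by (rule exchange[OF 2(1)[unfolded *]])
      (use 1 2 Q Q' K s DE in auto)
  moreover have "increment a s (insert v D) = increment a s D + a (Edge {s, v})"
    using DE s less finite_subset[OF _ fin] by (intro increment_insert[of _ _ _ u]) auto
  ultimately show ?thesis by simp
qed

text \<open>This is \<open>exchange\<close> with \<open>{v}\<close> as a third cluster, so the
  coefficient of \<open>{s, v}\<close> does not enter. For \<open>K = 3\<close> no further cluster
  is left, so \<open>D\<close> and \<open>E\<close> must exhaust the other vertices.\<close>

lemma increment_exchange_alone:
  assumes s: "s \<in> vertices n" "s \<noteq> v" and DE: "D \<noteq> {}" "E \<noteq> {}" "D \<inter> E = {}"
      "D \<union> E \<subseteq> vertices n - {s, v}"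
    and K: "K \<ge> 3" "K - 3 \<le> card (vertices n - {s, v} - (D \<union> E))"
      "K = 3 \<Longrightarrow> D \<union> E = vertices n - {s, v}"
  shows "increment a s D = increment a s E"
proof -
  let ?W = "vertices n - {s, v} - (D \<union> E)"
  have fin: "finite (vertices n)" by (simp add: vertices_def)
  obtain Q where Q: "partition_on ?W Q" "card Q = K - 3"
    using exists_partition_on_card[of ?W "K - 3"] K fin by auto
  have Q': "finite Q" using Q(1) fin by (meson finite_Diff finite_elements)
  have 1: "partition_on (E \<union> ?W) (insert E Q)" "E \<notin> Q"
    using partition_on_insert_disjoint[OF Q(1) DE(2)] by auto
  have 2: "partition_on (D \<union> (E \<union> ?W)) (insert D (insert E Q))"
      "D \<notin> insert E Q"
    using partition_on_insert_disjoint[OF 1(1) DE(1)] DE(3) by auto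
  have 3: "partition_on ({v} \<union> (D \<union> (E \<union> ?W))) (insert {v} (insert D (insert E Q)))"
      "{v} \<notin> insert D (insert E Q)"
    using partition_on_insert_disjoint[OF 2(1), of "{v}"] DE by auto
  have *: "{v} \<union> (D \<union> (E \<union> ?W)) = vertices n - {s}"
    using v s DE by auto
  show ?thesis
    by (rule exchange[OF 3(1)[unfolded *]])
      (use 1 2 3 Q Q' K s DE in auto)
qed

text \<open>Moving \<open>v\<close> from its cluster \<open>C\<close> into the cluster
  \<open>D\<close> of \<open>u\<close> leads onto the face. Both contain a vertex below
  \<open>v\<close>, so only edge coefficients at \<open>v\<close> enter: all are 0 in
  \<open>C\<close>, and only that of \<open>{u, v}\<close> can remain in \<open>D\<close>.\<close>

lemma form_value_off_face:
  assumes zero: "\<And>s. s \<in> vertices n - {u, v} \<Longrightarrow> a (Edge {s, v}) = 0"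
    and \<pi>: "K_partition n K \<pi>" and off: "\<not> (\<exists>C\<in>\<pi>. {u, v} \<subseteq> C)" "v \<notin> representatives \<pi>"
  shows "form_value n a \<pi> = b - a (Edge {u, v})"
proof -
  have part: "partition_on (vertices n) \<pi>" and card: "card \<pi> = K"
    using \<pi> by (auto simp: K_partition_def)
  have fin: "finite (vertices n)" by (simp add: vertices_def)
  obtain C D where CD: "C \<in> \<pi>" "v \<in> C" "D \<in> \<pi>" "u \<in> D"
    using u v unfolding partition_onD1[OF part] by blast
  have ne: "C \<noteq> D" using off CD by auto
  have disj: "\<And>C D. C \<in> \<pi> \<Longrightarrow> D \<in> \<pi> \<Longrightarrow> C \<noteq> D \<Longrightarrow> C \<inter> D = {}"
    using part by (auto simp: partition_on_def disjoint_def)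
  have sub: "C \<subseteq> vertices n" "D \<subseteq> vertices n"
    using part CD by (auto simp: partition_on_def)
  note finCD = sub[THEN finite_subset, OF fin]
  \<comment> \<open>As \<open>v\<close> is not a representative, \<open>m < v\<close>; so
    \<open>C - {v}\<close> is non-empty and \<open>v\<close> does not change its minimum.\<close>
  define m where "m = Min C"
  have "m \<in> C" "m \<le> v"
    unfolding m_def using CD finCD by (auto intro: Min_in)
  moreover have "m \<noteq> v"
    unfolding m_def using CD(1) off(2) by (auto simp: representatives_def)
  ultimately have m: "m \<in> C - {v}" "m < v" by auto
  define P where "P = insert (C - {v}) (\<pi> - {C})"
  have C': "C - {v} \<notin> \<pi> - {C}"
    using disj[of "C - {v}" C] CD(1) m(1) by blast
  have "partition_on (vertices n - C) (\<pi> - {C})"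
    using partition_on_insert[of C "\<pi> - {C}" "vertices n"] part CD(1) disj
    by (auto simp: insert_absorb disjnt_def)
  then have "partition_on ((C - {v}) \<union> (vertices n - C)) P"
    unfolding P_def using m(1) by (intro partition_on_insert_disjoint(1)) auto
  moreover have "(C - {v}) \<union> (vertices n - C) = vertices n - {v}"
    using CD sub by auto
  ultimately have P: "partition_on (vertices n - {v}) P" by simp
  \<comment> \<open>Putting \<open>v\<close> back where it was recovers \<open>\<pi>\<close>, so
    \<open>\<pi>\<close> and the face partition are two placements of \<open>v\<close> in the same
    \<open>P\<close>.\<close>
  have \<pi>_eq: "insert (insert v (C - {v})) (P - {C - {v}}) = \<pi>"
    using C' CD by (auto simp: P_def insert_absorb)
  have CP: "C - {v} \<in> P" by (simp add: P_def)
  have cardP: "card P = K"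
    using form_value_insert_element(1)[OF P v CP] card
    unfolding \<pi>_eq K_partition_def by simp
  have DP: "D \<in> P" using CD ne by (auto simp: P_def)
  have "v \<notin> D" using disj[OF CD(1,3) ne] CD by auto
  have "increment a v (C - {v}) = (\<Sum>t\<in>C - {v}. a (Edge {v, t}))"
    using m finCD by (intro increment_above) auto
  also have "\<dots> = 0"
    using off(1) CD sub by (intro sum.neutral ballI) (subst insert_commute, rule zero, auto)
  finally have 1: "increment a v (C - {v}) = 0" .
  have "increment a v D = (\<Sum>t\<in>D. a (Edge {v, t}))"
    using CD less finCD \<open>v \<notin> D\<close> by (intro increment_above) auto
  also have "\<dots> = (\<Sum>t\<in>{u}. a (Edge {v, t}))"
    using CD \<open>v \<notin> D\<close> sub finCD
    by (intro sum.mono_neutral_right) (auto simp: insert_commute[of v] intro!: zero)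
  finally have 2: "increment a v D = a (Edge {u, v})" by (simp add: insert_commute)
  have "form_value n a (insert (insert v D) (P - {D})) = b"
    using form_value_insert_element(1)[OF P v DP] CD cardP by (intro const) auto
  then show ?thesis
    using form_value_insert_element(2)[OF P v DP, of a]
      form_value_insert_element(2)[OF P v CP, of a] 1 2
    unfolding \<pi>_eq by simp
qed

section \<open>Vanishing of the edge coefficients at v\<close>

text \<open>Both exchanges apply to \<open>D = {u}\<close> and \<open>E = {t}\<close>, and their
  difference is the coefficient. The joined one takes \<open>K - 2\<close> clusters from
  \<open>n - 4\<close> vertices, which is where \<open>K + 2 \<le> n\<close> enters.\<close>

lemma edge_coeff_eq_0_K_ge_4:
  assumes "K \<ge> 4" "K + 2 \<le> n" and s: "s \<in> vertices n - {u, v}"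
  shows "a (Edge {s, v}) = 0"
proof -
  have "card (vertices n - {s, v, u}) = n - 3"
    using s u v less by (subst card_Diff_subset) (auto simp: vertices_def)
  then have "card (vertices n - {s, v, u}) > 0" using assms by simp
  then obtain t where t: "t \<in> vertices n - {s, v, u}"
    by (metis card_gt_0_iff all_not_in_conv)
  have "vertices n - {s, v} - ({u} \<union> {t}) = vertices n - {s, v, u, t}" by blast
  also have "card \<dots> = n - 4"
    using s u v t less by (subst card_Diff_subset) (auto simp: vertices_def)
  finally have card: "card (vertices n - {s, v} - ({u} \<union> {t})) = n - 4" .
  have "increment a s {t} = increment a s {u} + a (Edge {s, v})"
    by (rule increment_exchange_joined) (use s u t less assms card in auto)
  moreover have "increment a s {u} = increment a s {t}"
    by (rule increment_exchange_alone) (use s u t less assms card in auto)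
  ultimately show ?thesis by simp
qed

text \<open>With \<open>v\<close> alone, the partner of \<open>{u}\<close> must be all of
  \<open>T\<close>, whereas the joined exchange takes a proper subset of \<open>T\<close>. The gap
  is bridged by dropping the largest vertex \<open>M\<close> of \<open>T\<close>, whose coefficient
  with \<open>s\<close> is shown to be 0.\<close>

lemma edge_coeff_eq_0_K_3_n_ge_6:
  assumes "K = 3" "n \<ge> 6" and s: "s \<in> vertices n - {u, v}"
  shows "a (Edge {s, v}) = 0"
proof -
  have fin: "finite (vertices n)" by (simp add: vertices_def)
  define T where "T = vertices n - {s, v, u}"
  have card: "card T = n - 3"
    unfolding T_def using s u v less by (subst card_Diff_subset) (auto simp: vertices_def)
  have finT: "finite T" by (simp add: T_def fin)
  have joined: "increment a s E = increment a s {u} + a (Edge {s, v})"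
    if E: "E \<subset> T" "E \<noteq> {}" for E
  proof (rule increment_exchange_joined)
    have "vertices n - {s, v} - ({u} \<union> E) = T - E" by (auto simp: T_def)
    moreover have "T - E \<noteq> {}" using E by auto
    ultimately show "K - 2 \<le> card (vertices n - {s, v} - ({u} \<union> E))"
      using finT assms by (simp add: Suc_le_eq card_gt_0_iff)
  qed (use E s u less assms in \<open>auto simp: T_def\<close>)
  define M where "M = Max T"
  have M: "M \<in> T" using card assms finT by (auto simp: M_def intro!: Max_in)
  have "card (T - {M}) = n - 4" using card M by simp
  then have "card (T - {M}) > 0" using assms by simp
  then obtain t where t: "t \<in> T - {M}" by (metis card_gt_0_iff all_not_in_conv)
  have tM: "t < M" using t finT by (auto simp: M_def intro: le_neq_trans)
  \<comment> \<open>By \<open>n \<ge> 6\<close> the set \<open>T\<close> has at least three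
    elements.\<close>
  have "{M, t} \<noteq> T" using card assms t by (auto simp: card_insert_if)
  then have "{M, t} \<subset> T" "{t} \<subset> T" using t M by auto
  then have "increment a s {M, t} = increment a s {t}"
    using joined[of "{M, t}"] joined[of "{t}"] by simp
  then have zero: "a (Edge {s, M}) = 0"
    using increment_insert[of "{t}" s M t a] t tM M by (auto simp: T_def)
  have "increment a s {u} = increment a s T"
    by (rule increment_exchange_alone) (use s u less assms M in \<open>auto simp: T_def\<close>)
  also have "T = insert M (T - {M})" using M by auto
  also have "increment a s \<dots> = increment a s (T - {M})"
    using M t tM finT zero increment_insert[of "T - {M}" s M t a] by (auto simp: T_def)
  also have "\<dots> = increment a s {u} + a (Edge {s, v})"
    using M t by (intro joined) auto
  finally show ?thesis by simp
qed

text \<open>Only two vertices \<open>p < q\<close> remain besides \<open>s\<close>,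
  \<open>u\<close>, \<open>v\<close>, and the vertex order decides which increments split. The
  linear equations between them give 0 in every order except \<open>q < u\<close> with
  \<open>s < u\<close>, which means \<open>{u, v} = {4, 5}\<close>.\<close>

lemma edge_coeff_eq_0_K_3_n_5:
  assumes K: "K = 3" and n: "n = 5" and uv: "{u, v} \<noteq> {4, 5}"
    and s: "s \<in> vertices n - {u, v}"
  shows "a (Edge {s, v}) = 0"
proof -
  have "card (vertices n - {s, v, u}) = 2"
    using s u v less n by (subst card_Diff_subset) (auto simp: vertices_def)
  then obtain p' q' where "vertices n - {s, v, u} = {p', q'}" "p' \<noteq> q'"
    by (auto simp: card_2_iff)
  then obtain p q where pq: "vertices n - {s, v, u} = {p, q}" "p < q"
    by (metis insert_commute linorder_neqE_nat)
  have "p \<in> vertices n - {s, v, u}" "q \<in> vertices n - {s, v, u}"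
    unfolding pq(1) by simp_all
  then have ne: "u \<noteq> p" "u \<noteq> q" "p \<noteq> s" "q \<noteq> s" "p \<noteq> v" "q \<noteq> v" "s \<noteq> u" "s \<noteq> v"
    using s by auto
  have "vertices n - {s, v} = insert u (vertices n - {s, v, u})"
    using u ne less by auto
  then have rest: "vertices n - {s, v} = {u, p, q}" by (simp only: pq(1))
  have "p \<noteq> q" "q \<noteq> p" using pq(2) by auto
  note ne = this ne
  have joined: "increment a s {p} = increment a s {u} + a (Edge {s, v})"
    by (rule increment_exchange_joined) (use s ne K in \<open>simp_all add: rest insert_Diff_if\<close>)
  have joined': "increment a s {q} = increment a s {u} + a (Edge {s, v})"
    by (rule increment_exchange_joined) (use s ne K in \<open>simp_all add: rest insert_Diff_if\<close>)
  have alone: "increment a s D = increment a s E"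
    if "D \<noteq> {}" "E \<noteq> {}" "D \<inter> E = {}" "D \<union> E = {u, p, q}" for D E
    by (rule increment_exchange_alone) (use s ne K that in \<open>simp_all add: rest\<close>)
  have alone: "increment a s {u} = increment a s {p, q}"
      "increment a s {u, p} = increment a s {q}" "increment a s {u, q} = increment a s {p}"
    using ne pq(2) by (auto intro!: alone)
  have ins: "increment a s {x, y} = increment a s {x} + a (Edge {s, y})"
    if "x < y" "x \<noteq> s" "y \<noteq> s" for x y
    using increment_insert[of "{x}" s y x a] that by (simp add: insert_commute)
  have "increment a s {p, q} = increment a s {p} + a (Edge {s, q})"
    using pq(2) ne by (intro ins) auto
  then have q: "a (Edge {s, q}) = - a (Edge {s, v})"
    using alone(1) joined by linarith
  consider "u < q" | "q < u"
    using ne(4) by (metis linorder_neqE_nat)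
  then show ?thesis
  proof cases
    case 1
    then have "increment a s {u, q} = increment a s {u} + a (Edge {s, q})"
      using ne by (intro ins) auto
    \<comment> \<open>The increment at \<open>{u, q}\<close> is that at \<open>{u}\<close> minus the
      coefficient of \<open>{s, v}\<close>; by \<open>alone\<close> and \<open>joined\<close> it is
      also that at \<open>{u}\<close> plus the coefficient.\<close>
    then show ?thesis
      using alone joined joined' q by linarith
  next
    case 2
    \<comment> \<open>Otherwise \<open>s\<close>, \<open>p\<close>, \<open>q\<close> all lie below
      \<open>u < v\<close>, which forces the excluded pair 4, 5.\<close>
    have "s > u"
    proof (rule ccontr)
      assume "\<not> s > u"
      then have "s < u" using ne by simp
      have "{u, p, q} \<subseteq> vertices n" using rest by blast
      then have sub: "{s, p, q, u} \<subseteq> {1..<v}"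
        using \<open>s < u\<close> 2 pq(2) less s by (auto simp: vertices_def)
      have "card {s, p, q, u} = 4" using ne pq(2) by (auto simp: card_insert_if)
      then have "v \<ge> 5" using card_mono[OF _ sub] by auto
      then have "v = 5" using v n by (simp add: vertices_def)
      have "card {s, p, q} = 3" using ne pq(2) by (auto simp: card_insert_if)
      moreover have "{s, p, q} \<subseteq> {1..<u}"
        using \<open>s < u\<close> 2 pq(2) sub by auto
      ultimately have "u \<ge> 4" using card_mono[of "{1..<u}" "{s, p, q}"] by auto
      with \<open>v = 5\<close> less uv show False by auto
    qed
    have sing: "increment a s {x} = a (Edge {s, x})" if "x < s" for x
      using increment_above[of "{x}" s x a] that by auto
    have "increment a s {p, u} = increment a s {p} + a (Edge {s, u})"
      using 2 pq(2) ne by (intro ins) auto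
    moreover have "increment a s {p} = a (Edge {s, p})" "increment a s {q} = a (Edge {s, q})"
        "increment a s {u} = a (Edge {s, u})"
      using 2 pq(2) \<open>s > u\<close> by (auto intro!: sing)
    \<comment> \<open>The increment at \<open>{u}\<close> is 0, and that at \<open>{q}\<close> is
      both the coefficient of \<open>{s, v}\<close> and its negative.\<close>
    ultimately show ?thesis
      using alone joined joined' q unfolding insert_commute[of u p] by linarith
  qed
qed

lemma edge_coeff_eq_0:
  assumes "K \<ge> 3" "K + 2 \<le> n" "n \<ge> 6 \<or> {u, v} \<noteq> {4, 5}"
    and "s \<in> vertices n - {u, v}"
  shows "a (Edge {s, v}) = 0"
proof -
  consider "K \<ge> 4" | "K = 3" "n \<ge> 6" | "K = 3" "n = 5" "{u, v} \<noteq> {4, 5}"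
    using assms by linarith
  then show ?thesis
    using assms edge_coeff_eq_0_K_ge_4 edge_coeff_eq_0_K_3_n_ge_6 edge_coeff_eq_0_K_3_n_5
    by cases blast+
qed

end

section \<open>Representatives and the range of $K$\<close>

definition joined :: "nat set set \<Rightarrow> nat \<Rightarrow> nat \<Rightarrow> bool" where
  "joined \<pi> i j \<longleftrightarrow> (\<exists>C\<in>\<pi>. {i, j} \<subseteq> C)"

lemma char_entry_Edge: "char_entry \<pi> (Edge {i, j}) = of_bool (joined \<pi> i j)"
  by (simp add: joined_def)

lemma joined_sym: "joined \<pi> i j \<longleftrightarrow> joined \<pi> j i"
  by (auto simp: joined_def)

lemma joined_trans:
  assumes "partition_on A \<pi>" "joined \<pi> i j" "joined \<pi> j k"
  shows "joined \<pi> i k"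
proof -
  obtain C D where "C \<in> \<pi>" "{i, j} \<subseteq> C" "D \<in> \<pi>" "{j, k} \<subseteq> D"
    using assms by (auto simp: joined_def)
  moreover from this have "C = D"
    using assms(1) by (auto simp: partition_on_def disjoint_def)
  ultimately show ?thesis by (auto simp: joined_def)
qed

text \<open>A cluster with minimum \<open>w\<close> contains \<open>w\<close>, so it is the cluster
  of \<open>w\<close>. This expresses even the representatives 1, 2, 3, which have no coordinate,
  through edge coordinates.\<close>

lemma representatives_iff:
  assumes \<pi>: "partition_on (vertices n) \<pi>" and w: "w \<in> vertices n"
  shows "w \<in> representatives \<pi> \<longleftrightarrow> (\<forall>i\<in>{1..<w}. \<not> joined \<pi> i w)"
proof -
  obtain C where C: "C \<in> \<pi>" "w \<in> C"
    using w unfolding partition_onD1[OF \<pi>] by blast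
  have sub: "D \<subseteq> {1..n}" if "D \<in> \<pi>" for D
    using \<pi> that by (auto simp: partition_on_def vertices_def)
  have fin: "finite D" if "D \<in> \<pi>" for D
    using sub[OF that] by (rule finite_subset) simp
  have uniq: "D = C" if "D \<in> \<pi>" "w \<in> D" for D
    using \<pi> that C by (auto simp: partition_on_def disjoint_def)
  have ne: "D \<noteq> {}" if "D \<in> \<pi>" for D
    using \<pi> that by (auto simp: partition_on_def)
  have "w \<in> representatives \<pi> \<longleftrightarrow> w = Min C"
  proof
    assume "w \<in> representatives \<pi>"
    then obtain D where D: "D \<in> \<pi>" "w = Min D" by (auto simp: representatives_def)
    moreover have "w \<in> D" unfolding D(2) by (rule Min_in[OF fin[OF D(1)] ne[OF D(1)]])
    ultimately show "w = Min C" using uniq by simp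
  qed (use C in \<open>auto simp: representatives_def\<close>)
  also have "\<dots> \<longleftrightarrow> (\<forall>i\<in>C. w \<le> i)"
    using C(2) fin[OF C(1)] ne[OF C(1)] by (auto simp: eq_Min_iff)
  also have "\<dots> \<longleftrightarrow> (\<forall>i\<in>{1..<w}. i \<notin> C)"
    using sub[OF C(1)] by (meson atLeastAtMost_iff atLeastLessThan_iff not_le subsetD)
  also have "\<dots> \<longleftrightarrow> (\<forall>i\<in>{1..<w}. \<not> joined \<pi> i w)"
    unfolding joined_def using C uniq by (metis empty_subsetI insert_subset)
  finally show ?thesis .
qed

lemma representatives_subset:
  assumes \<pi>: "partition_on (vertices n) \<pi>"
  shows "representatives \<pi> \<subseteq> vertices n"
proof
  fix w assume "w \<in> representatives \<pi>"
  then obtain C where "C \<in> \<pi>" "w = Min C" by (auto simp: representatives_def)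
  moreover have "C \<subseteq> vertices n" "C \<noteq> {}"
    using \<pi> calculation by (auto simp: partition_on_def)
  moreover have "finite C"
    using calculation finite_subset by (auto simp: vertices_def)
  ultimately show "w \<in> vertices n" using Min_in by blast
qed

lemma sum_representatives:
  assumes "K_partition n K \<pi>"
  shows "(\<Sum>w=1..n. of_bool (w \<in> representatives \<pi>)) = real K"
proof -
  have \<pi>: "partition_on (vertices n) \<pi>" "card \<pi> = K"
    using assms by (auto simp: K_partition_def)
  have "(\<Sum>w=1..n. of_bool (w \<in> representatives \<pi>)) = real (card ({1..n} \<inter> representatives \<pi>))"
    by (simp add: of_bool_def sum.If_cases Int_def)
  also have "{1..n} \<inter> representatives \<pi> = representatives \<pi>"
    using representatives_subset[OF \<pi>(1)] by (auto simp: vertices_def)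
  also have "card (representatives \<pi>) = K"
    using inj_on_Min_partition[OF \<pi>(1)] \<pi>(2)
    by (simp add: representatives_def card_image vertices_def)
  finally show ?thesis .
qed

lemma representatives_1: "partition_on (vertices n) \<pi> \<Longrightarrow> 1 \<le> n \<Longrightarrow> 1 \<in> representatives \<pi>"
  and representatives_2: "partition_on (vertices n) \<pi> \<Longrightarrow> 2 \<le> n \<Longrightarrow>
    2 \<in> representatives \<pi> \<longleftrightarrow> \<not> joined \<pi> 1 2"
  and representatives_3: "partition_on (vertices n) \<pi> \<Longrightarrow> 3 \<le> n \<Longrightarrow>
    3 \<in> representatives \<pi> \<longleftrightarrow> \<not> joined \<pi> 1 3 \<and> \<not> joined \<pi> 2 3"
  and representatives_4: "partition_on (vertices n) \<pi> \<Longrightarrow> 4 \<le> n \<Longrightarrow>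
    4 \<in> representatives \<pi> \<longleftrightarrow> \<not> joined \<pi> 1 4 \<and> \<not> joined \<pi> 2 4 \<and> \<not> joined \<pi> 3 4"
  and representatives_5: "partition_on (vertices n) \<pi> \<Longrightarrow> 5 \<le> n \<Longrightarrow>
    5 \<in> representatives \<pi> \<longleftrightarrow>
      \<not> joined \<pi> 1 5 \<and> \<not> joined \<pi> 2 5 \<and> \<not> joined \<pi> 3 5 \<and> \<not> joined \<pi> 4 5"
proof -
  have "{1..<2::nat} = {1::nat}" "{1..<3::nat} = {1, 2}" "{1..<4::nat} = {1, 2, 3}"
      "{1..<5::nat} = {1, 2, 3, 4}"
    by auto
  note * = this and One_nat_def [simp del]
  show "partition_on (vertices n) \<pi> \<Longrightarrow> 1 \<le> n \<Longrightarrow> 1 \<in> representatives \<pi>"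
    by (subst representatives_iff) (auto simp: vertices_def)
  show "partition_on (vertices n) \<pi> \<Longrightarrow> 2 \<le> n \<Longrightarrow>
    2 \<in> representatives \<pi> \<longleftrightarrow> \<not> joined \<pi> 1 2"
    by (subst representatives_iff) (auto simp: vertices_def *)
  show "partition_on (vertices n) \<pi> \<Longrightarrow> 3 \<le> n \<Longrightarrow>
    3 \<in> representatives \<pi> \<longleftrightarrow> \<not> joined \<pi> 1 3 \<and> \<not> joined \<pi> 2 3"
    by (subst representatives_iff) (auto simp: vertices_def *)
  show "partition_on (vertices n) \<pi> \<Longrightarrow> 4 \<le> n \<Longrightarrow>
    4 \<in> representatives \<pi> \<longleftrightarrow> \<not> joined \<pi> 1 4 \<and> \<not> joined \<pi> 2 4 \<and> \<not> joined \<pi> 3 4"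
    by (subst representatives_iff) (auto simp: vertices_def *)
  show "partition_on (vertices n) \<pi> \<Longrightarrow> 5 \<le> n \<Longrightarrow>
    5 \<in> representatives \<pi> \<longleftrightarrow>
      \<not> joined \<pi> 1 5 \<and> \<not> joined \<pi> 2 5 \<and> \<not> joined \<pi> 3 5 \<and> \<not> joined \<pi> 4 5"
    by (subst representatives_iff) (auto simp: vertices_def *)
qed

section \<open>Coordinates of characteristic vectors\<close>

lemma char_vec_nth:
  assumes "bij_betw pos (coords n) UNIV" "c \<in> coords n"
  shows "char_vec n pos \<pi> $ pos c = char_entry \<pi> c"
  using assms by (simp add: char_vec_def bij_betw_def inv_into_f_f)

lemma Edge_in_coords: "i \<in> vertices n \<Longrightarrow> j \<in> vertices n \<Longrightarrow> i \<noteq> j \<Longrightarrow> Edge {i, j} \<in> coords n"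
  by (auto simp: coords_def edges_def)

lemma Rep_in_coords: "4 \<le> w \<Longrightarrow> w \<le> n \<Longrightarrow> Rep w \<in> coords n"
  by (auto simp: coords_def)

lemma char_vec_Edge:
  assumes "bij_betw pos (coords n) UNIV" "i \<in> vertices n" "j \<in> vertices n" "i \<noteq> j"
  shows "char_vec n pos \<pi> $ pos (Edge {i, j}) = of_bool (joined \<pi> i j)"
  using assms by (subst char_vec_nth) (simp_all only: Edge_in_coords char_entry_Edge not_False_eq_True)

lemma char_vec_Rep:
  assumes "bij_betw pos (coords n) UNIV" "4 \<le> w" "w \<le> n"
  shows "char_vec n pos \<pi> $ pos (Rep w) = of_bool (w \<in> representatives \<pi>)"
  using assms by (simp add: char_vec_nth Rep_in_coords)

lemma inner_char_vec:
  fixes a :: "real ^ 'e::finite"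
  assumes "bij_betw pos (coords n) UNIV"
  shows "a \<bullet> char_vec n pos \<pi> = form_value n (\<lambda>c. a $ pos c) \<pi>"
proof -
  have "a \<bullet> char_vec n pos \<pi> = (\<Sum>i\<in>UNIV. a $ i * char_vec n pos \<pi> $ i)"
    by (simp add: inner_vec_def)
  also have "\<dots> = (\<Sum>c\<in>coords n. a $ pos c * char_vec n pos \<pi> $ pos c)"
    using assms by (rule sum.reindex_bij_betw[symmetric])
  finally show ?thesis
    using assms by (simp add: form_value_def char_vec_nth)
qed

section \<open>The range of K and validity of the inequality\<close>

lemma full_dimensional_polytope_const:
  fixes pos :: "coord \<Rightarrow> 'e::finite"
  assumes "full_dimensional (partition_polytope n K pos)" and "linear h"
    and "\<And>\<pi>. K_partition n K \<pi> \<Longrightarrow> h (char_vec n pos \<pi>) = (c::real)"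
  shows "h x = 0"
  using assms unfolding partition_polytope_def
  by (intro full_dimensional_linear_const) auto

text \<open>For every other \<open>K\<close> a nonzero linear form is constant on all
  \<open>K\<close>-partitions; each form is tested at a unit vector where its value is 1.\<close>

lemma full_dimensional_K_bounds:
  fixes pos :: "coord \<Rightarrow> 'e::finite"
  assumes pos: "bij_betw pos (coords n) UNIV"
    and full: "full_dimensional (partition_polytope n K pos)" and n: "n \<ge> 4"
  shows "K \<ge> 3" and "K + 2 \<le> n"
proof -
  note const = full_dimensional_polytope_const[OF full]
  have E: "Edge {1, 2} \<in> coords n" "Edge {1, 3} \<in> coords n" "Edge {2, 3} \<in> coords n"
      "Edge {1, 4} \<in> coords n" "Edge {2, 4} \<in> coords n" "Edge {3, 4} \<in> coords n"
    using n by (auto intro!: Edge_in_coords simp: vertices_def)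
  note One_nat_def [simp del]
  have V: "1 \<in> vertices n" "2 \<in> vertices n" "3 \<in> vertices n" "4 \<in> vertices n"
    using n by (auto simp: vertices_def)
  note nth = char_vec_Edge[OF pos] char_vec_Rep[OF pos] V
  have inj: "pos c = pos d \<longleftrightarrow> c = d" if "c \<in> coords n" "d \<in> coords n" for c d
    using pos that by (auto simp: bij_betw_def inj_on_def)
  have interval: "{1..n} = {1, 2, 3, 4} \<union> {5..n}" "{1..n} = {1, 2, 3} \<union> {4..n}"
    using n by auto
  have reps: "of_bool (1 \<in> representatives \<pi>) + of_bool (2 \<in> representatives \<pi>)
      + of_bool (3 \<in> representatives \<pi>) + (\<Sum>w=4..n. of_bool (w \<in> representatives \<pi>)) = real K"
    if "K_partition n K \<pi>" for \<pi>
    using sum_representatives[OF that] unfolding interval(2)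
    by (subst (asm) sum.union_disjoint) auto
  have "\<not> K \<le> 1"
  proof
    assume "K \<le> 1"
    have "(\<lambda>x::real^'e. x $ pos (Edge {1, 2})) (axis (pos (Edge {1, 2})) 1) = 0"
    proof (rule const)
      fix \<pi> assume \<pi>: "K_partition n K \<pi>"
      then have part: "partition_on (vertices n) \<pi>" by (simp add: K_partition_def)
      have "(\<Sum>w=4..n. of_bool (w \<in> representatives \<pi>)) \<ge> (0::real)"
        by (intro sum_nonneg) auto
      with reps[OF \<pi>] \<open>K \<le> 1\<close> representatives_1[OF part] n
      have "2 \<notin> representatives \<pi>" by (auto simp: of_bool_def split: if_splits)
      then show "char_vec n pos \<pi> $ pos (Edge {1, 2}) = 1"
        using representatives_2[OF part] n by (simp add: nth)
    qed (auto intro!: linearI)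
    then show False by (simp add: axis_def)
  qed
  moreover have "K \<noteq> 2"
  proof
    assume K: "K = 2"
    \<comment> \<open>With two clusters, either 1, 2, 3 are together and one representative lies
      above 3, giving 3 - 2, or exactly one pair of them is joined and no representative lies above
      3, giving 1.\<close>
    define h where "h = (\<lambda>x::real^'e. x $ pos (Edge {1, 2}) + x $ pos (Edge {1, 3})
        + x $ pos (Edge {2, 3}) - 2 * (\<Sum>w=4..n. x $ pos (Rep w)))"
    have "h (axis (pos (Edge {1, 2})) 1) = 0"
    proof (rule const)
      show "linear h"
        unfolding h_def
        by (intro linearI) (simp_all add: algebra_simps sum.distrib sum_distrib_left)
      fix \<pi> assume \<pi>: "K_partition n K \<pi>"
      then have part: "partition_on (vertices n) \<pi>" by (simp add: K_partition_def)
      have "(\<Sum>w=4..n. of_bool (w \<in> representatives \<pi>)) \<ge> (0::real)"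
        by (intro sum_nonneg) auto
      moreover have "(\<Sum>w=4..n. char_vec n pos \<pi> $ pos (Rep w)) =
          (\<Sum>w=4..n. of_bool (w \<in> representatives \<pi>))"
        by (intro sum.cong) (auto simp: nth)
      ultimately show "h (char_vec n pos \<pi>) = 1"
        using reps[OF \<pi>] K n representatives_1[OF part] representatives_2[OF part]
          representatives_3[OF part] joined_trans[OF part, of 2 1 3] joined_trans[OF part, of 1 2 3]
          joined_trans[OF part, of 1 3 2] joined_sym[of \<pi> 1 2] joined_sym[of \<pi> 2 3]
        by (cases "joined \<pi> 1 2"; cases "joined \<pi> 1 3"; cases "joined \<pi> 2 3")
          (simp_all add: h_def nth)
    qed
    moreover have "(\<Sum>w=4..n. axis (pos (Edge {1, 2})) (1::real) $ pos (Rep w)) = 0"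
      using E by (intro sum.neutral) (auto simp: axis_def inj Rep_in_coords)
    ultimately show False
      using E by (simp add: h_def axis_def inj doubleton_eq_iff)
  qed
  ultimately show "K \<ge> 3" by linarith
  show "K + 2 \<le> n"
  proof (rule ccontr)
    assume K: "\<not> K + 2 \<le> n"
    have R: "Rep 4 \<in> coords n" using n by (intro Rep_in_coords) auto
    \<comment> \<open>At most one vertex is not a representative. If it is 4, then 1, 2, 3 lie in
      distinct clusters and 4 is joined to exactly one of them.\<close>
    define h where "h = (\<lambda>x::real^'e. x $ pos (Rep 4) + x $ pos (Edge {1, 4})
        + x $ pos (Edge {2, 4}) + x $ pos (Edge {3, 4}))"
    have "h (axis (pos (Rep 4)) 1) = 0"
    proof (rule const)
      show "linear h"
        unfolding h_def by (intro linearI) (simp_all add: algebra_simps)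
      fix \<pi> assume \<pi>: "K_partition n K \<pi>"
      then have part: "partition_on (vertices n) \<pi>" by (simp add: K_partition_def)
      have "(\<Sum>w=5..n. of_bool (w \<in> representatives \<pi>)) \<le> (\<Sum>w=5..n. 1::real)"
        by (intro sum_mono) auto
      moreover have "of_bool (1 \<in> representatives \<pi>) + of_bool (2 \<in> representatives \<pi>)
          + of_bool (3 \<in> representatives \<pi>) + of_bool (4 \<in> representatives \<pi>)
          + (\<Sum>w=5..n. of_bool (w \<in> representatives \<pi>)) = real K"
        using sum_representatives[OF \<pi>] unfolding interval(1)
        by (subst (asm) sum.union_disjoint) auto
      ultimately have "of_bool (2 \<in> representatives \<pi>) + of_bool (3 \<in> representatives \<pi>)
          + of_bool (4 \<in> representatives \<pi>) \<ge> (2::real)"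
        using K n representatives_1[OF part] by simp
      then show "h (char_vec n pos \<pi>) = 1"
        using n representatives_2[OF part] representatives_3[OF part] representatives_4[OF part]
          joined_trans[OF part, of 1 4 2] joined_trans[OF part, of 1 4 3]
          joined_trans[OF part, of 2 4 3] joined_sym[of \<pi> 4]
        by (cases "joined \<pi> 1 4"; cases "joined \<pi> 2 4"; cases "joined \<pi> 3 4")
          (auto simp: h_def nth of_bool_def split: if_splits)
    qed
    then show False
      using E R by (simp add: h_def axis_def inj)
  qed
qed

text \<open>A half-space is convex, so characteristic vectors suffice; there a smaller
  \<open>u\<close> in the cluster of \<open>v\<close> prevents \<open>v\<close> from being its
  representative.\<close>

lemma facet_inequality_valid:
  fixes pos :: "coord \<Rightarrow> 'e::finite"
  assumes pos: "bij_betw pos (coords n) UNIV" and "u \<in> vertices n" "v \<in> vertices n" "v \<ge> 4" "u < v"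
    and x: "x \<in> partition_polytope n K pos"
  shows "x $ pos (Edge {u, v}) + x $ pos (Rep v) \<le> 1"
proof -
  have "partition_polytope n K pos \<subseteq>
      {x. (axis (pos (Edge {u, v})) 1 + axis (pos (Rep v)) 1) \<bullet> x \<le> 1}"
    unfolding partition_polytope_def
  proof (intro hull_minimal convex_halfspace_le)
    have "\<not> joined \<pi> u v" if "partition_on (vertices n) \<pi>" "v \<in> representatives \<pi>" for \<pi>
      using that assms representatives_iff[of n \<pi> v] by (auto simp: vertices_def)
    then show "char_vec n pos ` {\<pi>. K_partition n K \<pi>} \<subseteq>
        {x. (axis (pos (Edge {u, v})) 1 + axis (pos (Rep v)) 1) \<bullet> x \<le> 1}"
      using assms
      by (auto simp: inner_add_left inner_axis' char_vec_Edge char_vec_Rep K_partition_def vertices_def)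
  qed
  then show ?thesis
    using x by (auto simp: inner_add_left inner_axis')
qed

section \<open>The exceptional case and the theorem\<close>

text \<open>The relation is \<open>joined\<close> on \<open>{1, 2, 3, 4}\<close>, and \<open>r\<close> counts the representatives other than 1:
  \<open>r = 2\<close> when 5 is joined to 4 and \<open>r = 1\<close> when 5 is a singleton. The two conclusions combine
  into the second equation of the face.\<close>

lemma equivalence_on_4_count:
  fixes e12 e13 e23 e14 e24 e34 :: bool
  assumes "e12 \<Longrightarrow> e13 \<Longrightarrow> e23" "e12 \<Longrightarrow> e23 \<Longrightarrow> e13" "e13 \<Longrightarrow> e23 \<Longrightarrow> e12"
    and "e12 \<Longrightarrow> e14 \<Longrightarrow> e24" "e12 \<Longrightarrow> e24 \<Longrightarrow> e14" "e14 \<Longrightarrow> e24 \<Longrightarrow> e12"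
    and "e13 \<Longrightarrow> e14 \<Longrightarrow> e34" "e13 \<Longrightarrow> e34 \<Longrightarrow> e14" "e14 \<Longrightarrow> e34 \<Longrightarrow> e13"
    and "e23 \<Longrightarrow> e24 \<Longrightarrow> e34" "e23 \<Longrightarrow> e34 \<Longrightarrow> e24" "e24 \<Longrightarrow> e34 \<Longrightarrow> e23"
  defines "r \<equiv> of_bool (\<not> e12) + of_bool (\<not> e13 \<and> \<not> e23) +
      of_bool (\<not> e14 \<and> \<not> e24 \<and> \<not> e34) :: real"
  shows "r = 2 \<Longrightarrow> of_bool e12 + of_bool e13 + of_bool e23
      - 2 * of_bool (\<not> e14 \<and> \<not> e24 \<and> \<not> e34)
      - of_bool e14 - of_bool e24 - of_bool e34 = (- 1 :: real)"
    and "r = 1 \<Longrightarrow> of_bool e12 + of_bool e13 + of_bool e23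
      - 2 * of_bool (\<not> e14 \<and> \<not> e24 \<and> \<not> e34) = (1 :: real)"
proof -
  \<comment> \<open>The implications are sorted by the value of one pair: an equivalence if it is
    joined, an exclusion otherwise.\<close>
  have 1: "e23 \<longleftrightarrow> e13" if e12 using assms that by blast
  have 2: "\<not> (e13 \<and> e23)" if "\<not> e12" using assms that by blast
  have 3: "e24 \<longleftrightarrow> e14" if e12 using assms that by blast
  have 4: "\<not> (e14 \<and> e24)" if "\<not> e12" using assms that by blast
  have 5: "e34 \<longleftrightarrow> e14" if e13 using assms that by blast
  have 6: "\<not> (e14 \<and> e34)" if "\<not> e13" using assms that by blast
  have 7: "e34 \<longleftrightarrow> e24" if e23 using assms that by blast
  have 8: "\<not> (e24 \<and> e34)" if "\<not> e23" using assms that by blast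
  show "r = 2 \<Longrightarrow> of_bool e12 + of_bool e13 + of_bool e23
      - 2 * of_bool (\<not> e14 \<and> \<not> e24 \<and> \<not> e34)
      - of_bool e14 - of_bool e24 - of_bool e34 = (- 1 :: real)"
   and "r = 1 \<Longrightarrow> of_bool e12 + of_bool e13 + of_bool e23
      - 2 * of_bool (\<not> e14 \<and> \<not> e24 \<and> \<not> e34) = (1 :: real)"
    unfolding r_def using 1 2 3 4 5 6 7 8
    by (cases e12; cases e13; cases e23; cases e14; cases e24; cases e34; simp)+
qed

text \<open>The face also satisfies \<open>g \<bullet> x = 1\<close>. If 5 is joined to 4, its
  relation to 1, 2, 3 is that of 4, and the term 2 from \<open>Edge {4, 5}\<close> lifts the count
  -1 to 1; if 5 is a singleton, all its edge terms vanish and the count is 1 already.\<close>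

lemma not_facet_n_5:
  fixes pos :: "coord \<Rightarrow> 'e::finite"
  assumes pos: "bij_betw pos (coords 5) UNIV"
  shows "aff_dim {x \<in> partition_polytope 5 3 pos. x $ pos (Edge {4, 5}) + x $ pos (Rep 5) = 1}
    < int DIM(real ^ 'e) - 1"
proof -
  note One_nat_def [simp del]
  define f where "f = axis (pos (Edge {4, 5})) 1 + (axis (pos (Rep 5)) 1 :: real ^ 'e)"
  define g where "g = axis (pos (Edge {1, 2})) 1 + axis (pos (Edge {1, 3})) 1
      + axis (pos (Edge {2, 3})) 1 - 2 *\<^sub>R axis (pos (Rep 4)) 1 + 2 *\<^sub>R axis (pos (Edge {4, 5})) 1
      - axis (pos (Edge {1, 5})) 1 - axis (pos (Edge {2, 5})) 1
      - (axis (pos (Edge {3, 5})) 1 :: real ^ 'e)"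
  have f: "f \<bullet> x = x $ pos (Edge {4, 5}) + x $ pos (Rep 5)" for x
    by (simp add: f_def inner_add_left inner_axis')
  have g: "g \<bullet> x = x $ pos (Edge {1, 2}) + x $ pos (Edge {1, 3}) + x $ pos (Edge {2, 3})
      - 2 * x $ pos (Rep 4) + 2 * x $ pos (Edge {4, 5})
      - x $ pos (Edge {1, 5}) - x $ pos (Edge {2, 5}) - x $ pos (Edge {3, 5})" for x
    by (simp add: g_def inner_add_left inner_diff_left inner_axis')
  have V: "1 \<in> vertices 5" "2 \<in> vertices 5" "3 \<in> vertices 5" "4 \<in> vertices 5" "5 \<in> vertices 5"
    by (auto simp: vertices_def)
  note nth = char_vec_Edge[OF pos] char_vec_Rep[OF pos] V
  \<comment> \<open>Off the face \<open>f \<bullet> x = 0\<close> at vertices, so any large constant in place of 20 will do. In this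
    form the equation \<open>g \<bullet> x = 1\<close> on the face passes from vertices to the convex hull.\<close>
  have bound: "\<bar>g \<bullet> x - 1\<bar> \<le> 20 * (1 - f \<bullet> x)" if "x \<in> char_vec 5 pos ` {\<pi>. K_partition 5 3 \<pi>}" for x
  proof -
    obtain \<pi> where x: "x = char_vec 5 pos \<pi>" and \<pi>: "K_partition 5 3 \<pi>" using \<open>x \<in> _\<close> by auto
    then have part: "partition_on (vertices 5) \<pi>" by (simp add: K_partition_def)
    have "{1..5::nat} = {1, 2, 3, 4, 5}" by auto
    then have sum: "of_bool (1 \<in> representatives \<pi>) + (of_bool (2 \<in> representatives \<pi>)
        + (of_bool (3 \<in> representatives \<pi>) + (of_bool (4 \<in> representatives \<pi>)
        + of_bool (5 \<in> representatives \<pi>)))) = (3::real)"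
      using sum_representatives[OF \<pi>] by (simp del: sum_of_bool_eq)
    note r = representatives_1[OF part] representatives_2[OF part] representatives_3[OF part]
      representatives_4[OF part] representatives_5[OF part]
    have same: "joined \<pi> i 4 \<longleftrightarrow> joined \<pi> i 5" if "joined \<pi> 4 5" for i
      using joined_trans[OF part, of i 4 5] joined_trans[OF part, of i 5 4] that
        joined_sym[of \<pi> 4 5] by blast
    have trans: "joined \<pi> i j \<Longrightarrow> joined \<pi> i k \<Longrightarrow> joined \<pi> j k"
        "joined \<pi> i j \<Longrightarrow> joined \<pi> j k \<Longrightarrow> joined \<pi> i k"
        "joined \<pi> i k \<Longrightarrow> joined \<pi> j k \<Longrightarrow> joined \<pi> i j" for i j k
      using joined_trans[OF part] joined_sym by blast+
    have count: "of_bool (joined \<pi> 1 2) + of_bool (joined \<pi> 1 3) + of_bool (joined \<pi> 2 3)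
        - 2 * of_bool (4 \<in> representatives \<pi>)
        - of_bool (joined \<pi> 1 4) - of_bool (joined \<pi> 2 4) - of_bool (joined \<pi> 3 4) = (- 1 :: real)"
      if "5 \<notin> representatives \<pi>"
      using equivalence_on_4_count(1)[of "joined \<pi> 1 2" "joined \<pi> 1 3" "joined \<pi> 2 3"
          "joined \<pi> 1 4" "joined \<pi> 2 4" "joined \<pi> 3 4", OF trans trans trans trans] sum r that
      by simp
    have count': "of_bool (joined \<pi> 1 2) + of_bool (joined \<pi> 1 3) + of_bool (joined \<pi> 2 3)
        - 2 * of_bool (4 \<in> representatives \<pi>) = (1 :: real)"
      if "5 \<in> representatives \<pi>"
      using equivalence_on_4_count(2)[of "joined \<pi> 1 2" "joined \<pi> 1 3" "joined \<pi> 2 3"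
          "joined \<pi> 1 4" "joined \<pi> 2 4" "joined \<pi> 3 4", OF trans trans trans trans] sum r that
      by simp
    have fx: "f \<bullet> x = of_bool (joined \<pi> 4 5) + of_bool (5 \<in> representatives \<pi>)"
      by (simp add: f x nth)
    have gx: "g \<bullet> x = of_bool (joined \<pi> 1 2) + of_bool (joined \<pi> 1 3) + of_bool (joined \<pi> 2 3)
        - 2 * of_bool (4 \<in> representatives \<pi>) + 2 * of_bool (joined \<pi> 4 5)
        - of_bool (joined \<pi> 1 5) - of_bool (joined \<pi> 2 5) - of_bool (joined \<pi> 3 5)"
      by (simp add: g x nth)
    consider "joined \<pi> 4 5" | "5 \<in> representatives \<pi>"
      | "\<not> joined \<pi> 4 5" "5 \<notin> representatives \<pi>" by blast
    then show ?thesis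
    proof cases
      case 1
      then have "5 \<notin> representatives \<pi>" using r by simp
      moreover have "g \<bullet> x = 1"
        unfolding gx using 1 count[OF \<open>5 \<notin> _\<close>] by (simp add: same[OF 1])
      ultimately show ?thesis using 1 by (simp add: fx)
    next
      case 2
      then have "\<not> joined \<pi> 1 5" "\<not> joined \<pi> 2 5" "\<not> joined \<pi> 3 5" "\<not> joined \<pi> 4 5"
        using r by auto
      moreover from this have "g \<bullet> x = 1"
        unfolding gx using count'[OF 2] by simp
      ultimately show ?thesis using 2 by (simp add: fx)
    next
      case 3
      have "0 \<le> (of_bool P :: real)" "(of_bool P :: real) \<le> 1" for P by auto
      note this[of "joined \<pi> 1 2"] this[of "joined \<pi> 1 3"] this[of "joined \<pi> 2 3"]
        this[of "4 \<in> representatives \<pi>"]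
        this[of "joined \<pi> 1 5"] this[of "joined \<pi> 2 5"] this[of "joined \<pi> 3 5"]
      with 3 show ?thesis unfolding fx gx by (simp add: abs_le_iff)
    qed
  qed
  \<comment> \<open>The two signs of the absolute value give two half-spaces; where
    \<open>f \<bullet> x = 1\<close> they say \<open>g \<bullet> x \<le> 1\<close> and
    \<open>g \<bullet> x \<ge> 1\<close>.\<close>
  have "char_vec 5 pos ` {\<pi>. K_partition 5 3 \<pi>} \<subseteq>
      {x. (g + 20 *\<^sub>R f) \<bullet> x \<le> 21} \<inter> {x. (20 *\<^sub>R f - g) \<bullet> x \<le> 19}"
    using bound by (fastforce simp: inner_add_left inner_diff_left)
  then have "partition_polytope 5 3 pos \<subseteq>
      {x. (g + 20 *\<^sub>R f) \<bullet> x \<le> 21} \<inter> {x. (20 *\<^sub>R f - g) \<bullet> x \<le> 19}"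
    unfolding partition_polytope_def
    by (intro hull_minimal convex_Int convex_halfspace_le)
  then have sub: "{x \<in> partition_polytope 5 3 pos. f \<bullet> x = 1} \<subseteq> {x. g \<bullet> x = 1}"
    by (fastforce simp: inner_add_left inner_diff_left)
  have inj: "pos c = pos d \<longleftrightarrow> c = d" if "c \<in> coords 5" "d \<in> coords 5" for c d
    using pos that by (auto simp: bij_betw_def inj_on_def)
  note E = Edge_in_coords[of _ 5] Rep_in_coords[of _ 5]
  \<comment> \<open>The coordinate \<open>Rep 5\<close> occurs in \<open>f\<close> but not in
    \<open>g\<close>, so this point separates the two hyperplanes.\<close>
  define p :: "real ^ 'e" where "p = axis (pos (Rep 5)) 1"
  have "f \<bullet> p = 1" unfolding f p_def using V by (simp add: axis_def inj E)
  moreover have "g \<bullet> p = 0" unfolding g p_def using V by (simp add: axis_def inj E)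
  ultimately have "aff_dim {x \<in> partition_polytope 5 3 pos. f \<bullet> x = 1} < int DIM(real ^ 'e) - 1"
    using sub by (intro aff_dim_two_hyperplanes[of _ f 1 g 1 p]) auto
  then show ?thesis by (simp only: f)
qed

theorem theorem4p3:
  fixes n K u v :: nat
    and pos :: "coord \<Rightarrow> 'e::finite"
  assumes "bij_betw pos (coords n) UNIV"
    and "full_dimensional (partition_polytope n K pos)"
    and "u \<in> vertices n" and "v \<in> vertices n"
    and "v \<ge> 4" and "u < v"
  shows "facet_defining (partition_polytope n K pos)
           (\<lambda>x. x $ pos (Edge {u, v}) + x $ pos (Rep v)) 1
         \<longleftrightarrow> n \<ge> 6 \<or> {u, v} \<noteq> {4, 5}"
proof -
  note pos = assms(1) and full = assms(2) and u = assms(3) and v = assms(4)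
  have v': "1 \<le> v" "v \<le> n" using v by (auto simp: vertices_def)
  let ?P = "partition_polytope n K pos"
  let ?F = "{x \<in> ?P. x $ pos (Edge {u, v}) + x $ pos (Rep v) = 1}"
  have facet_iff: "facet_defining ?P (\<lambda>x. x $ pos (Edge {u, v}) + x $ pos (Rep v)) 1 \<longleftrightarrow>
      aff_dim ?F = int DIM(real ^ 'e) - 1"
    using facet_inequality_valid[OF pos u v assms(5,6)] full
    by (auto simp: facet_defining_def full_dimensional_def)
  have K: "K \<ge> 3" "K + 2 \<le> n"
    using full_dimensional_K_bounds[OF pos full] v' \<open>v \<ge> 4\<close> by auto
  have in_P: "char_vec n pos \<pi> \<in> ?P" if "K_partition n K \<pi>" for \<pi>
    using that by (auto simp: partition_polytope_def intro: hull_inc)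
  have lhs: "char_vec n pos \<pi> $ pos (Edge {u, v}) + char_vec n pos \<pi> $ pos (Rep v) =
      of_bool (joined \<pi> u v) + of_bool (v \<in> representatives \<pi>)" for \<pi>
    using char_vec_Edge[OF pos u v] char_vec_Rep[OF pos] v' assms(5,6) by simp
  \<comment> \<open>By validity the two indicators are never both 1, so either one gives
    equality.\<close>
  have on_face: "char_vec n pos \<pi> \<in> ?F"
    if \<pi>: "K_partition n K \<pi>" and "joined \<pi> u v \<or> v \<in> representatives \<pi>" for \<pi>
  proof -
    have "of_bool (joined \<pi> u v) + of_bool (v \<in> representatives \<pi>) \<le> (1::real)"
      using facet_inequality_valid[OF pos u v assms(5,6) in_P[OF \<pi>]] by (simp only: lhs)
    with that in_P[OF \<pi>] show ?thesis by (auto simp: lhs)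
  qed
  show ?thesis
  proof (intro iffI)
    assume facet: "facet_defining ?P (\<lambda>x. x $ pos (Edge {u, v}) + x $ pos (Rep v)) 1"
    show "n \<ge> 6 \<or> {u, v} \<noteq> {4, 5}"
    proof (rule ccontr)
      assume "\<not> ?thesis"
      then have uv: "{u, v} = {4, 5}" and "n < 6" by auto
      with assms(6) have [simp]: "u = 4" "v = 5" by (auto simp: doubleton_eq_iff)
      \<comment> \<open>From \<open>5 \<le> n < 6\<close> and
        \<open>3 \<le> K \<le> n - 2\<close>.\<close>
      have [simp]: "n = 5" "K = 3" using v' \<open>n < 6\<close> K by auto
      show False
        using facet facet_iff not_facet_n_5[of pos] pos by simp
    qed
  next
    assume cond: "n \<ge> 6 \<or> {u, v} \<noteq> {4, 5}"
    define f where "f = axis (pos (Edge {u, v})) 1 + (axis (pos (Rep v)) 1 :: real ^ 'e)"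
    have f: "f \<bullet> x = x $ pos (Edge {u, v}) + x $ pos (Rep v)" for x
      by (simp add: f_def inner_add_left inner_axis')
    have "Edge {u, v} \<in> coords n" "Rep v \<in> coords n"
      using u v v' assms(5,6) by (auto intro: Edge_in_coords Rep_in_coords)
    then have "pos (Edge {u, v}) \<noteq> pos (Rep v)"
      using pos by (auto simp: bij_betw_def dest: inj_onD)
    then have "f \<bullet> axis (pos (Rep v)) 1 = 1" by (simp add: f axis_def)
    then have f_nonzero: "f \<noteq> 0" by auto
    \<comment> \<open>Otherwise the nonzero form given by \<open>f\<close> would be constant on all
      \<open>K\<close>-partitions, against full dimension.\<close>
    have "\<exists>\<rho>. K_partition n K \<rho> \<and> \<not> joined \<rho> u v \<and> v \<notin> representatives \<rho>"
    proof (rule ccontr)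
      assume "\<not> ?thesis"
      then have "f \<bullet> char_vec n pos \<pi> = 1" if "K_partition n K \<pi>" for \<pi>
        using on_face[OF that] that unfolding f by blast
      then have "f \<bullet> x = 0" for x
        by (intro full_dimensional_polytope_const[OF full, of "(\<bullet>) f" 1])
          (auto intro: bounded_linear.linear bounded_linear_inner_right)
      then show False using f_nonzero by (metis inner_eq_zero_iff)
    qed
    then obtain \<rho> where \<rho>: "K_partition n K \<rho>" "\<not> joined \<rho> u v" "v \<notin> representatives \<rho>"
      by blast
    have "aff_dim ?F = int DIM(real ^ 'e) - 1"
    proof (rule aff_dim_eq_DIM_minus_1[where p = "char_vec n pos \<rho>"])
      show "f \<noteq> 0" by fact
      show "?F \<subseteq> {x. f \<bullet> x = 1}" by (auto simp: f)
    next
      fix a :: "real ^ 'e" and b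
      assume eq_b: "\<And>x. x \<in> insert (char_vec n pos \<rho>) ?F \<Longrightarrow> a \<bullet> x = b"
      define a' where "a' = (\<lambda>c. a $ pos c)"
      have val: "a \<bullet> char_vec n pos \<pi> = form_value n a' \<pi>" for \<pi>
        unfolding a'_def by (rule inner_char_vec[OF pos])
      interpret constant_on_face n K u v a' b
      proof
        fix \<pi> assume \<pi>: "K_partition n K \<pi>" "(\<exists>C\<in>\<pi>. {u, v} \<subseteq> C) \<or> {v} \<in> \<pi>"
        then have "joined \<pi> u v \<or> v \<in> representatives \<pi>"
          by (force simp: joined_def representatives_def)
        with on_face[OF \<pi>(1)] eq_b show "form_value n a' \<pi> = b"
          by (simp only: val[symmetric] insert_iff simp_thms)
      qed (use u v assms(6) in auto)
      have zero: "a' (Edge {s, v}) = 0" if "s \<in> vertices n - {u, v}" for s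
        using edge_coeff_eq_0[OF K cond that] .
      have off: "form_value n a' \<pi> = b - a' (Edge {u, v})"
        if "K_partition n K \<pi>" "\<not> joined \<pi> u v" "v \<notin> representatives \<pi>" for \<pi>
        using form_value_off_face[OF zero that(1)] that(2,3) by (simp add: joined_def)
      have "form_value n a' \<rho> = b"
        using eq_b[of "char_vec n pos \<rho>"] val by simp
      \<comment> \<open>The value at \<open>\<rho>\<close> is \<open>b\<close> because
        \<open>\<rho>\<close> was adjoined, and \<open>b - a' (Edge {u, v})\<close> because it is
        off the face.\<close>
      then have "a' (Edge {u, v}) = 0" using off[OF \<rho>] by simp
      then have "a \<bullet> char_vec n pos \<pi> = b" if "K_partition n K \<pi>" for \<pi>
        using off[OF that] on_face[OF that] eq_b[of "char_vec n pos \<pi>"] val by fastforce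
      then have "a \<bullet> a = 0"
        by (intro full_dimensional_polytope_const[OF full, of "(\<bullet>) a" b])
          (auto intro: bounded_linear.linear bounded_linear_inner_right)
      then show "a = 0" by simp
    qed
    then show "facet_defining ?P (\<lambda>x. x $ pos (Edge {u, v}) + x $ pos (Rep v)) 1"
      by (simp only: facet_iff)
  qed
qed

end
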